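(* Let $\{X_k, k\in\mathbb{N}\}$ be a standardized Gaussian process. Assume that its dependence measure satisfies $$\sum_{i=1}^\infty\sqrt[3]{\frac{\Delta(\lfloor\gamma^i\rfloor)}{\lfloor\gamma^i\rfloor^2}}<+\infty\qquad\text{for every real } \gamma>1.$$ Then $$\sup_{t\in\mathbb{R}}\left|\widehat{F}_n(t)-\mathbf{E}\widehat{F}_n(t)\right|\xrightarrow{a.s.}0\quad\text{as } n\to\infty,$$ where $\xrightarrow{a.s.}$ denotes almost sure convergence.
   Context: Here $\mathbb{N}=\{1,2,3,\dots\}$ and $\lfloor\cdot\rfloor$ is the floor function. A stochastic process $\{X_k,k\in\mathbb{N}\}$ of real random variables on a common probability space is a Gaussian process if for every finite set of indices $\{k_1,\dots,k_m\}$, $m\ge 1$, the joint distribution of $(X_{k_1},\dots,X_{k_m})$ is multivariate Gaussian (possibly degenerate). It is a standardized Gaussian process if in addition $X_k\sim\mathcal{N}(0,1)$ for every $k\in\mathbb{N}$. Let $\Phi$ be the cumulative distribution function of the standard Gaussian $\mathcal{N}(0,1)$. The empirical distribution is $$\widehat{F}_n(t)=\frac1n\sum_{i=1}^n\mathbf{1}(\Phi(X_i)\le t),\qquad t\in\mathbb{R},$$ where $\mathbf{1}(A)$ is the indicator of the event $A$. The dependence measure is $$\Delta(n)=2\sum_{1\le i<j\le n}|\mathrm{Cov}(X_i,X_j)|$$ (so $\Delta(1)=0$). *)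

theory Defs
  imports "HOL-Probability.Probability"
begin

text \<open>
  Laws of random vectors indexed by a finite set \<open>I\<close> are measures on the product space
  \<open>PiM I (\<lambda>_. borel)\<close>.  A multivariate Gaussian law is the law of \<open>\<mu> + A Z\<close>, where \<open>Z\<close> has
  independent standard Gaussian components.  It has mean \<open>\<mu>\<close> and covariance matrix \<open>A A\<^sup>T\<close>.
  The matrix \<open>A\<close> may be singular, so degenerate laws are included.  Taking \<open>A\<close> square is no
  restriction, since every positive semidefinite matrix has the form \<open>A A\<^sup>T\<close> with \<open>A\<close> square.
\<close>

definition multivariate_gaussian :: "'i set \<Rightarrow> ('i \<Rightarrow> real) measure \<Rightarrow> bool" where
  "multivariate_gaussian I N \<longleftrightarrow>
     (\<exists>(\<mu> :: 'i \<Rightarrow> real) (A :: 'i \<Rightarrow> 'i \<Rightarrow> real).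
        N = distr (PiM I (\<lambda>_. std_normal_distribution)) (PiM I (\<lambda>_. borel))
              (\<lambda>z. \<lambda>i\<in>I. \<mu> i + (\<Sum>j\<in>I. A i j * z j)))"

text \<open>
  Processes are indexed by the positive integers; the value of \<open>X\<close> at index \<open>0\<close> is
  unconstrained and never used.
\<close>

definition gaussian_process :: "'a measure \<Rightarrow> (nat \<Rightarrow> 'a \<Rightarrow> real) \<Rightarrow> bool" where
  "gaussian_process M X \<longleftrightarrow>
     (\<forall>k\<ge>1. X k \<in> borel_measurable M) \<and>
     (\<forall>I. finite I \<and> I \<noteq> {} \<and> I \<subseteq> {1..} \<longrightarrow>
        multivariate_gaussian I (distr M (PiM I (\<lambda>_. borel)) (\<lambda>\<omega>. \<lambda>i\<in>I. X i \<omega>)))"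

definition standardized_gaussian_process :: "'a measure \<Rightarrow> (nat \<Rightarrow> 'a \<Rightarrow> real) \<Rightarrow> bool" where
  "standardized_gaussian_process M X \<longleftrightarrow>
     gaussian_process M X \<and> (\<forall>k\<ge>1. distributed M lborel (X k) std_normal_density)"

definition std_normal_cdf :: "real \<Rightarrow> real" where
  "std_normal_cdf = cdf std_normal_distribution"

definition empirical_distribution ::
    "(nat \<Rightarrow> 'a \<Rightarrow> real) \<Rightarrow> nat \<Rightarrow> real \<Rightarrow> 'a \<Rightarrow> real" where
  "empirical_distribution X n t \<omega> =
     (1 / real n) * (\<Sum>i=1..n. indicat_real {..t} (std_normal_cdf (X i \<omega>)))"

definition covariance :: "'a measure \<Rightarrow> ('a \<Rightarrow> real) \<Rightarrow> ('a \<Rightarrow> real) \<Rightarrow> real" where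
  "covariance M X Y =
     (LINT \<omega>|M. (X \<omega> - (LINT \<omega>'|M. X \<omega>')) * (Y \<omega> - (LINT \<omega>'|M. Y \<omega>')))"

definition dependence_measure :: "'a measure \<Rightarrow> (nat \<Rightarrow> 'a \<Rightarrow> real) \<Rightarrow> nat \<Rightarrow> real" where
  "dependence_measure M X n =
     2 * (\<Sum>(i, j) \<in> {(i, j). 1 \<le> i \<and> i < j \<and> j \<le> n}. \<bar>covariance M (X i) (X j)\<bar>)"

end

theory Submission
  imports Defs
begin

text \<open>
  The proof goes through characteristic functions. Let \<open>\<phi> n u\<close> be the average of \<open>iexp (u * X k)\<close> over
  \<open>1 \<le> k \<le> n\<close>, the characteristic function of the empirical measure of \<open>X 1, ..., X n\<close>. Its expectation
  is \<open>exp (- u\<^sup>2 / 2)\<close>. The covariance of \<open>iexp (u * X k)\<close> and \<open>iexp (u * X l)\<close> involves only the law of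
  \<open>X k - X l\<close>, which is normal with mean \<open>0\<close> and variance \<open>2 - 2 * r\<close>, where \<open>r\<close> is the correlation; so it
  equals \<open>exp (- u\<^sup>2 * (1 - r)) - exp (- u\<^sup>2)\<close> and is at most \<open>u\<^sup>2 * \<bar>r\<bar>\<close> in absolute value
  (\<open>norm_iexp_covariance_le\<close>). Summing over all pairs bounds the mean square deviation of \<open>\<phi> n u\<close> from
  its expectation by \<open>1 / n + u\<^sup>2 * \<Delta>(n) / n\<^sup>2\<close> (\<open>second_moment_sum_iexp_le\<close>).

  By hypothesis this bound is summable along \<open>n = \<lfloor>\<gamma> ^ i\<rfloor>\<close>, which gives almost sure convergence along
  each such subsequence. The summands are bounded, so the averages change little between consecutive
  members when \<open>\<gamma>\<close> is close to \<open>1\<close>, and the whole sequence converges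
  (\<open>averages_tendsto_0_if_geometric_subsequences\<close>).

  The exceptional null set depends on \<open>u\<close>. By Fubini, almost surely \<open>\<phi> n u\<close> converges for Lebesgue-almost
  every \<open>u\<close>, and for characteristic functions this implies convergence at every \<open>u\<close>
  (\<open>char_tendsto_if_AE_char_tendsto\<close>). Levy's continuity theorem then says that almost surely the
  empirical measures converge weakly to the standard normal law, whose distribution function \<open>\<Phi>\<close> is
  continuous. After the change of variable \<open>t = \<Phi> x\<close> this is pointwise convergence of the
  empirical distribution to its expectation \<open>t\<close> on the unit interval. Monotonicity makes it uniform there
  (\<open>eventually_uniformly_close_to_identity\<close>), and elsewhere both sides agree.
\<close>


section \<open>Linear functionals of Gaussian vectors\<close>

text \<open>
  Setting \<open>f\<close> to be the product of the two coordinate factors writes \<open>z i * z j\<close> as a product of one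
  function per coordinate, in both cases \<open>i = j\<close> and \<open>i \<noteq> j\<close>, so that Fubini applies.
\<close>

lemma integral_std_normal_product_coordinates:
  assumes I: "finite I" "i \<in> I" "j \<in> I"
  shows "integrable (PiM I (\<lambda>_. std_normal_distribution)) (\<lambda>z. z i * z j)"
    and "(\<integral>z. z i * z j \<partial>PiM I (\<lambda>_. std_normal_distribution)) = (if i = j then 1 else 0)"
proof -
  interpret R: real_distribution std_normal_distribution
    by (rule real_dist_normal_dist)
  interpret P: product_sigma_finite "\<lambda>_. std_normal_distribution"
    by standard
  define f :: "'a \<Rightarrow> real \<Rightarrow> real"
    where "f = (\<lambda>m x. (if m = i then x else 1) * (if m = j then x else 1))"
  have prod: "(\<Prod>m\<in>I. f m (z m)) = z i * z j" for z
    using I by (simp add: f_def prod.distrib prod.delta)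
  have int: "integrable std_normal_distribution (f m)" for m
    using integrable_std_normal_distribution_moment[of 1]
      integrable_std_normal_distribution_moment[of 2]
    by (cases "m = i"; cases "m = j") (simp_all add: f_def power2_eq_square)
  have val: "(\<integral>x. f m x \<partial>std_normal_distribution) = (if (m = i) = (m = j) then 1 else 0)" for m
    using integral_std_normal_distribution_moment_odd[of 1]
      std_normal_distribution_even_moments(1)[of 1] R.prob_space
    by (cases "m = i"; cases "m = j") (simp_all add: f_def power2_eq_square)
  show "integrable (PiM I (\<lambda>_. std_normal_distribution)) (\<lambda>z. z i * z j)"
    using P.product_integrable_prod[OF I(1), of f, OF int] by (simp add: prod)
  have "(\<integral>z. z i * z j \<partial>PiM I (\<lambda>_. std_normal_distribution)) =
      (\<Prod>m\<in>I. if (m = i) = (m = j) then 1 else 0)"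
    using P.product_integral_prod[OF I(1), of f, OF int] by (simp add: prod val)
  also have "\<dots> = (if i = j then 1 else 0)"
  proof (cases "i = j")
    case False
    with I show ?thesis by (auto intro!: prod_zero bexI[of _ i])
  qed simp
  finally show "(\<integral>z. z i * z j \<partial>PiM I (\<lambda>_. std_normal_distribution)) = (if i = j then 1 else 0)" .
qed

lemma integral_std_normal_product_coordinate:
  assumes I: "finite I" "i \<in> I"
  shows "integrable (PiM I (\<lambda>_. std_normal_distribution)) (\<lambda>z. z i)"
    and "(\<integral>z. z i \<partial>PiM I (\<lambda>_. std_normal_distribution)) = 0"
proof -
  interpret R: real_distribution std_normal_distribution
    by (rule real_dist_normal_dist)
  interpret P: product_sigma_finite "\<lambda>_. std_normal_distribution"
    by standard
  define f :: "'a \<Rightarrow> real \<Rightarrow> real" where "f = (\<lambda>m x. if m = i then x else 1)"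
  have prod: "(\<Prod>m\<in>I. f m (z m)) = z i" for z
    using I by (simp add: f_def prod.delta)
  have int: "integrable std_normal_distribution (f m)" for m
    using integrable_std_normal_distribution_moment[of 1] by (cases "m = i") (simp_all add: f_def)
  have val: "(\<integral>x. f i x \<partial>std_normal_distribution) = 0"
    using integral_std_normal_distribution_moment_odd[of 1] by (auto simp: f_def)
  show "integrable (PiM I (\<lambda>_. std_normal_distribution)) (\<lambda>z. z i)"
    using P.product_integrable_prod[OF I(1), of f, OF int] by (simp add: prod)
  show "(\<integral>z. z i \<partial>PiM I (\<lambda>_. std_normal_distribution)) = 0"
    unfolding prod[symmetric] P.product_integral_prod[OF I(1), of f, OF int]
    using I val by (intro prod_zero) auto
qed

lemma iexp_linear_form_std_normal_product:
  fixes c :: "'i \<Rightarrow> real"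
  assumes "finite I"
  shows "(CLINT z|PiM I (\<lambda>_. std_normal_distribution). iexp (\<Sum>j\<in>I. c j * z j)) =
      exp (- (\<Sum>j\<in>I. (c j)\<^sup>2) / 2)"
proof -
  interpret R: real_distribution std_normal_distribution
    by (rule real_dist_normal_dist)
  interpret P: product_sigma_finite "\<lambda>_. std_normal_distribution"
    by standard
  have "(CLINT z|PiM I (\<lambda>_. std_normal_distribution). iexp (\<Sum>j\<in>I. c j * z j)) =
      (CLINT z|PiM I (\<lambda>_. std_normal_distribution). (\<Prod>j\<in>I. iexp (c j * z j)))"
    using assms by (simp add: exp_sum sum_distrib_left)
  also have "\<dots> = (\<Prod>j\<in>I. char std_normal_distribution (c j))"
    unfolding char_def
    by (rule P.product_integral_prod[OF assms]) (rule R.integrable_iexp, auto)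
  also have "\<dots> = exp (- (\<Sum>j\<in>I. (c j)\<^sup>2) / 2)"
    using assms
    by (simp add: char_std_normal_distribution exp_sum[symmetric] sum_negf sum_divide_distrib
        flip: of_real_prod)
  finally show ?thesis .
qed

text \<open>
  A linear functional of \<open>\<mu> + A Z\<close> is a constant plus a linear form in the independent coordinates
  of \<open>Z\<close>. So its law is the normal law with the same mean and variance, here expressed by its
  characteristic function at \<open>1\<close> (the scaling can be put into \<open>a\<close>), which also covers variance zero.
\<close>

lemma multivariate_gaussian_linear_functional:
  fixes a :: "'i \<Rightarrow> real"
  assumes N: "multivariate_gaussian I N" and I: "finite I"
  defines "L \<equiv> \<lambda>x. \<Sum>i\<in>I. a i * x i"
  shows "(CLINT x|N. iexp (L x)) =
      iexp (\<integral>x. L x \<partial>N) * exp (- (\<integral>x. (L x - (\<integral>x. L x \<partial>N))\<^sup>2 \<partial>N) / 2)"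
proof -
  obtain \<mu> A where N_eq: "N = distr (PiM I (\<lambda>_. std_normal_distribution)) (PiM I (\<lambda>_. borel))
        (\<lambda>z. \<lambda>i\<in>I. \<mu> i + (\<Sum>j\<in>I. A i j * z j))"
    using N unfolding multivariate_gaussian_def by blast
  define S where "S = PiM I (\<lambda>_. std_normal_distribution)"
  interpret S: prob_space S
    unfolding S_def using real_dist_normal_dist
    by (intro prob_space_PiM) (simp add: real_distribution_def)
  define m where "m = (\<Sum>i\<in>I. a i * \<mu> i)"
  define c where "c j = (\<Sum>i\<in>I. a i * A i j)" for j
  define W where "W z = (\<Sum>j\<in>I. c j * z j)" for z
  have T [measurable]: "(\<lambda>z. \<lambda>i\<in>I. \<mu> i + (\<Sum>j\<in>I. A i j * z j)) \<in> S \<rightarrow>\<^sub>M PiM I (\<lambda>_. borel)"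
    unfolding S_def by measurable
  have L_meas [measurable]: "L \<in> borel_measurable (PiM I (\<lambda>_. borel))"
    unfolding L_def by measurable
  have LT: "L (\<lambda>i\<in>I. \<mu> i + (\<Sum>j\<in>I. A i j * z j)) = m + W z" for z
  proof -
    have "(\<Sum>i\<in>I. \<Sum>j\<in>I. a i * (A i j * z j)) = W z"
      unfolding W_def c_def sum_distrib_right by (subst sum.swap) (simp add: mult.assoc)
    then show ?thesis
      by (simp add: L_def m_def distrib_left sum.distrib sum_distrib_left)
  qed
  have int_W: "integrable S W" and W_mean: "(\<integral>z. W z \<partial>S) = 0"
  proof -
    note coord = integral_std_normal_product_coordinate[OF I, folded S_def]
    show "integrable S W"
      unfolding W_def
      by (intro Bochner_Integration.integrable_sum integrable_mult_right coord(1))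
    have "(\<integral>z. W z \<partial>S) = (\<Sum>j\<in>I. \<integral>z. c j * z j \<partial>S)"
      unfolding W_def
      by (intro Bochner_Integration.integral_sum integrable_mult_right coord(1))
    also have "\<dots> = (\<Sum>j\<in>I. 0)"
      by (intro sum.cong refl) (simp add: coord(2))
    finally show "(\<integral>z. W z \<partial>S) = 0"
      by simp
  qed
  have W_sq: "(\<integral>z. (W z)\<^sup>2 \<partial>S) = (\<Sum>j\<in>I. (c j)\<^sup>2)"
  proof -
    have *: "(W z)\<^sup>2 = (\<Sum>i\<in>I. \<Sum>j\<in>I. c i * c j * (z i * z j))" for z
      by (simp add: W_def power2_eq_square sum_product mult_ac)
    note coords = integral_std_normal_product_coordinates[OF I, folded S_def]
    have "(\<integral>z. (W z)\<^sup>2 \<partial>S) = (\<Sum>i\<in>I. \<integral>z. (\<Sum>j\<in>I. c i * c j * (z i * z j)) \<partial>S)"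
      unfolding * by (rule Bochner_Integration.integral_sum)
        (intro Bochner_Integration.integrable_sum integrable_mult_right coords(1))
    also have "\<dots> = (\<Sum>i\<in>I. \<Sum>j\<in>I. \<integral>z. c i * c j * (z i * z j) \<partial>S)"
      by (intro sum.cong refl Bochner_Integration.integral_sum integrable_mult_right coords(1))
    also have "\<dots> = (\<Sum>i\<in>I. \<Sum>j\<in>I. if i = j then (c j)\<^sup>2 else 0)"
      by (intro sum.cong refl) (simp add: coords(2) power2_eq_square)
    also have "\<dots> = (\<Sum>j\<in>I. (c j)\<^sup>2)"
      using I by simp
    finally show ?thesis .
  qed
  have mean: "(\<integral>x. L x \<partial>N) = m"
    unfolding N_eq S_def[symmetric] integral_distr[OF T L_meas] LT
    using int_W W_mean by (simp add: S.prob_space)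
  have var: "(\<integral>x. (L x - m)\<^sup>2 \<partial>N) = (\<Sum>j\<in>I. (c j)\<^sup>2)"
  proof -
    have "(\<lambda>x. (L x - m)\<^sup>2) \<in> borel_measurable (PiM I (\<lambda>_. borel))"
      by measurable
    from integral_distr[OF T this] show ?thesis
      unfolding N_eq S_def[symmetric] LT by (simp add: W_sq)
  qed
  have "(CLINT x|N. iexp (L x)) = (CLINT z|S. iexp m * iexp (W z))"
  proof -
    have "(\<lambda>x. iexp (L x)) \<in> borel_measurable (PiM I (\<lambda>_. borel))"
      by measurable
    from integral_distr[OF T this] show ?thesis
      unfolding N_eq S_def[symmetric] LT by (simp add: distrib_left exp_add)
  qed
  also have "\<dots> = iexp m * exp (- (\<Sum>j\<in>I. (c j)\<^sup>2) / 2)"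
    using iexp_linear_form_std_normal_product[OF I, of c] by (simp add: W_def S_def)
  finally show ?thesis
    by (simp add: mean var)
qed


section \<open>Covariances of the exponentials of a standardized Gaussian process\<close>

lemma distr_standardized_gaussian_process:
  assumes "standardized_gaussian_process M X" "k \<ge> 1"
  shows "X k \<in> borel_measurable M" and "distr M borel (X k) = std_normal_distribution"
proof -
  have "distributed M lborel (X k) std_normal_density"
    using assms unfolding standardized_gaussian_process_def by blast
  then show "X k \<in> borel_measurable M" "distr M borel (X k) = std_normal_distribution"
    unfolding distributed_def by (auto cong: distr_cong)
qed

lemma standardized_gaussian_process_moments:
  assumes "standardized_gaussian_process M X" "k \<ge> 1"
  shows "integrable M (X k)" and "(\<integral>\<omega>. X k \<omega> \<partial>M) = 0"
    and "integrable M (\<lambda>\<omega>. (X k \<omega>)\<^sup>2)" and "(\<integral>\<omega>. (X k \<omega>)\<^sup>2 \<partial>M) = 1"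
    and "(CLINT \<omega>|M. iexp (u * X k \<omega>)) = exp (- u\<^sup>2 / 2)"
proof -
  note [measurable] = distr_standardized_gaussian_process(1)[OF assms]
  note distr = distr_standardized_gaussian_process(2)[OF assms, symmetric]
  show "integrable M (X k)"
    using integrable_std_normal_distribution_moment[of 1]
    by (simp add: distr integrable_distr_eq)
  show "(\<integral>\<omega>. X k \<omega> \<partial>M) = 0"
    using integral_std_normal_distribution_moment_odd[of 1]
    by (simp add: distr integral_distr)
  show "integrable M (\<lambda>\<omega>. (X k \<omega>)\<^sup>2)"
    using integrable_std_normal_distribution_moment[of 2]
    by (simp add: distr integrable_distr_eq)
  show "(\<integral>\<omega>. (X k \<omega>)\<^sup>2 \<partial>M) = 1"
    using std_normal_distribution_even_moments(1)[of 1]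
    by (simp add: distr integral_distr)
  have "char (distr M borel (X k)) u = exp (- u\<^sup>2 / 2)"
    by (simp add: char_std_normal_distribution distr[symmetric])
  then show "(CLINT \<omega>|M. iexp (u * X k \<omega>)) = exp (- u\<^sup>2 / 2)"
    by (simp add: char_def integral_distr)
qed

lemma standardized_gaussian_process_covariance:
  assumes X: "standardized_gaussian_process M X" and kl: "k \<ge> 1" "l \<ge> 1"
  shows "covariance M (X k) (X l) = (\<integral>\<omega>. X k \<omega> * X l \<omega> \<partial>M)"
    and "(\<integral>\<omega>. (X k \<omega> - X l \<omega>)\<^sup>2 \<partial>M) = 2 - 2 * covariance M (X k) (X l)"
proof -
  note mk = standardized_gaussian_process_moments[OF X kl(1)]
  note ml = standardized_gaussian_process_moments[OF X kl(2)]
  note [measurable] = distr_standardized_gaussian_process(1)[OF X kl(1)]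
    distr_standardized_gaussian_process(1)[OF X kl(2)]
  show cov: "covariance M (X k) (X l) = (\<integral>\<omega>. X k \<omega> * X l \<omega> \<partial>M)"
    by (simp add: covariance_def mk(2) ml(2))
  have int: "integrable M (\<lambda>\<omega>. X k \<omega> * X l \<omega>)"
  proof (rule Bochner_Integration.integrable_bound)
    show "integrable M (\<lambda>\<omega>. (X k \<omega>)\<^sup>2 + (X l \<omega>)\<^sup>2)"
      using mk(3) ml(3) by simp
    have "\<bar>x * y\<bar> \<le> x\<^sup>2 + y\<^sup>2" for x y :: real
    proof -
      have "2 * \<bar>x * y\<bar> \<le> x\<^sup>2 + y\<^sup>2"
        using sum_squares_bound[of "\<bar>x\<bar>" "\<bar>y\<bar>"] by (simp add: abs_mult)
      moreover have "0 \<le> \<bar>x * y\<bar>"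
        by simp
      ultimately show ?thesis
        by linarith
    qed
    then show "AE \<omega> in M. norm (X k \<omega> * X l \<omega>) \<le> norm ((X k \<omega>)\<^sup>2 + (X l \<omega>)\<^sup>2)"
      by simp
  qed measurable
  have "(\<integral>\<omega>. (X k \<omega> - X l \<omega>)\<^sup>2 \<partial>M) =
      (\<integral>\<omega>. (X k \<omega>)\<^sup>2 + (X l \<omega>)\<^sup>2 - 2 * (X k \<omega> * X l \<omega>) \<partial>M)"
    by (simp add: power2_diff mult.assoc)
  also have "\<dots> = 2 - 2 * covariance M (X k) (X l)"
    using mk(3,4) ml(3,4) int by (simp add: cov)
  finally show "(\<integral>\<omega>. (X k \<omega> - X l \<omega>)\<^sup>2 \<partial>M) = 2 - 2 * covariance M (X k) (X l)" .
qed

lemma standardized_gaussian_process_covariance_le_1: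
  assumes "standardized_gaussian_process M X" "k \<ge> 1" "l \<ge> 1"
  shows "covariance M (X k) (X l) \<le> 1"
proof -
  have "0 \<le> (\<integral>\<omega>. (X k \<omega> - X l \<omega>)\<^sup>2 \<partial>M)"
    by simp
  then show ?thesis
    using standardized_gaussian_process_covariance(2)[OF assms] by simp
qed

text \<open>
  The difference \<open>X k - X l\<close> is a linear functional of the Gaussian vector \<open>(X k, X l)\<close>. It is centered
  and has variance \<open>2 - 2 * covariance M (X k) (X l)\<close>. The case \<open>k = l\<close> is separate, because then
  the index set \<open>{k, l}\<close> does not carry two coefficients.
\<close>

lemma iexp_difference_standardized_gaussian_process:
  assumes M: "prob_space M" and X: "standardized_gaussian_process M X" and kl: "k \<ge> 1" "l \<ge> 1"
  shows "(CLINT \<omega>|M. iexp (u * (X k \<omega> - X l \<omega>))) =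
      exp (- u\<^sup>2 * (1 - covariance M (X k) (X l)))"
proof (cases "k = l")
  case True
  interpret prob_space M by fact
  have "covariance M (X k) (X l) = 1"
    using standardized_gaussian_process_covariance(1)[OF X kl]
      standardized_gaussian_process_moments(4)[OF X kl(1)] True
    by (simp add: power2_eq_square)
  with True show ?thesis
    by (simp add: prob_space)
next
  case False
  define I where "I = {k, l}"
  define T where "T \<omega> = (\<lambda>i\<in>I. X i \<omega>)" for \<omega>
  define N where "N = distr M (PiM I (\<lambda>_. borel)) T"
  define a where "a i = (if i = k then u else - u)" for i
  define L where "L x = (\<Sum>i\<in>I. a i * x i)" for x :: "nat \<Rightarrow> real"
  note mk = standardized_gaussian_process_moments[OF X kl(1)]
  note ml = standardized_gaussian_process_moments[OF X kl(2)]
  have I: "finite I" "I \<noteq> {}" "I \<subseteq> {1..}"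
    using kl by (auto simp: I_def)
  have T [measurable]: "T \<in> M \<rightarrow>\<^sub>M PiM I (\<lambda>_. borel)"
    unfolding T_def using I(3) distr_standardized_gaussian_process(1)[OF X]
    by (intro measurable_restrict) auto
  have L_meas [measurable]: "L \<in> borel_measurable (PiM I (\<lambda>_. borel))"
    unfolding L_def by measurable
  have LT: "L (T \<omega>) = u * (X k \<omega> - X l \<omega>)" for \<omega>
    using False by (auto simp: L_def T_def I_def a_def algebra_simps)
  have "multivariate_gaussian I N"
    using X I unfolding standardized_gaussian_process_def gaussian_process_def N_def T_def by blast
  from multivariate_gaussian_linear_functional[OF this I(1), of a, folded L_def]
  have main: "(CLINT x|N. iexp (L x)) =
      iexp (\<integral>x. L x \<partial>N) * exp (- (\<integral>x. (L x - (\<integral>x. L x \<partial>N))\<^sup>2 \<partial>N) / 2)" .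
  have lhs: "(CLINT x|N. iexp (L x)) = (CLINT \<omega>|M. iexp (u * (X k \<omega> - X l \<omega>)))"
  proof -
    have "(\<lambda>x. iexp (L x)) \<in> borel_measurable (PiM I (\<lambda>_. borel))"
      by measurable
    from integral_distr[OF T this] show ?thesis
      unfolding N_def LT .
  qed
  have mean: "(\<integral>x. L x \<partial>N) = 0"
    unfolding N_def integral_distr[OF T L_meas] LT using mk(1,2) ml(1,2) by simp
  have var: "(\<integral>x. (L x)\<^sup>2 \<partial>N) = u\<^sup>2 * (2 - 2 * covariance M (X k) (X l))"
  proof -
    have "(\<lambda>x. (L x)\<^sup>2) \<in> borel_measurable (PiM I (\<lambda>_. borel))"
      by measurable
    from integral_distr[OF T this] show ?thesis
      unfolding N_def LT power_mult_distrib
      by (simp add: standardized_gaussian_process_covariance(2)[OF X kl])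
  qed
  have "- (u\<^sup>2 * (2 - 2 * covariance M (X k) (X l))) / 2 = - u\<^sup>2 * (1 - covariance M (X k) (X l))"
    by (simp add: field_simps)
  then show ?thesis
    using main unfolding lhs mean diff_0_right var by simp
qed

lemma iexp_covariance_standardized_gaussian_process:
  fixes M :: "'a measure" and u :: real
  assumes M: "prob_space M" and X: "standardized_gaussian_process M X" and kl: "k \<ge> 1" "l \<ge> 1"
  defines "Y \<equiv> \<lambda>k \<omega>. iexp (u * X k \<omega>) - exp (- u\<^sup>2 / 2)"
  shows "integrable M (\<lambda>\<omega>. Y k \<omega> * cnj (Y l \<omega>))"
    and "(CLINT \<omega>|M. Y k \<omega> * cnj (Y l \<omega>)) =
      exp (- u\<^sup>2 * (1 - covariance M (X k) (X l))) - exp (- u\<^sup>2)"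
proof -
  interpret prob_space M by fact
  note [measurable] = distr_standardized_gaussian_process(1)[OF X kl(1)]
    distr_standardized_gaussian_process(1)[OF X kl(2)]
  define c :: complex where "c = exp (- u\<^sup>2 / 2)"
  \<comment> \<open>Every term on the right is a constant or a multiple of an exponential of known expectation.\<close>
  have Y_eq: "Y k \<omega> * cnj (Y l \<omega>) = iexp (u * (X k \<omega> - X l \<omega>))
      - c * iexp (u * X k \<omega>) - c * iexp ((- u) * X l \<omega>) + c * c" for \<omega>
  proof -
    have 1: "iexp (u * (X k \<omega> - X l \<omega>)) = iexp (u * X k \<omega>) * iexp ((- u) * X l \<omega>)"
      by (simp add: exp_add[symmetric] algebra_simps)
    have 2: "cnj (Y l \<omega>) = iexp ((- u) * X l \<omega>) - c"
      by (simp add: Y_def c_def exp_cnj)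
    have 3: "Y k \<omega> = iexp (u * X k \<omega>) - c"
      by (simp add: Y_def c_def)
    show ?thesis
      unfolding 1 2 3 by (simp only: algebra_simps)
  qed
  have int: "integrable M (\<lambda>\<omega>. iexp (f \<omega>))" if "f \<in> borel_measurable M" for f :: "'a \<Rightarrow> real"
    using that by (intro integrable_iexp) auto
  have i1: "integrable M (\<lambda>\<omega>. iexp (u * (X k \<omega> - X l \<omega>)))"
    and i2: "integrable M (\<lambda>\<omega>. iexp (u * X k \<omega>))"
    and i3: "integrable M (\<lambda>\<omega>. iexp ((- u) * X l \<omega>))"
    by (rule int, measurable)+
  note ints = i1 integrable_mult_right[OF i2, of c] integrable_mult_right[OF i3, of c]
    integrable_const[of "c * c"]
  show "integrable M (\<lambda>\<omega>. Y k \<omega> * cnj (Y l \<omega>))"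
    unfolding Y_eq
    by (intro Bochner_Integration.integrable_add Bochner_Integration.integrable_diff ints)
  have "(CLINT \<omega>|M. Y k \<omega> * cnj (Y l \<omega>)) =
      (CLINT \<omega>|M. iexp (u * (X k \<omega> - X l \<omega>))) - c * (CLINT \<omega>|M. iexp (u * X k \<omega>))
      - c * (CLINT \<omega>|M. iexp ((- u) * X l \<omega>)) + c * c"
  proof -
    have "(CLINT \<omega>|M. Y k \<omega> * cnj (Y l \<omega>)) =
        (CLINT \<omega>|M. iexp (u * (X k \<omega> - X l \<omega>))) - (CLINT \<omega>|M. c * iexp (u * X k \<omega>))
        - (CLINT \<omega>|M. c * iexp ((- u) * X l \<omega>)) + (CLINT \<omega>|M. c * c)"
      unfolding Y_eq using ints
      by (simp only: Bochner_Integration.integral_add Bochner_Integration.integral_diff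
          Bochner_Integration.integrable_diff)
    then show ?thesis
      by (simp only: integral_mult_right_zero lebesgue_integral_const prob_space scaleR_one)
  qed
  also have "\<dots> = exp (- u\<^sup>2 * (1 - covariance M (X k) (X l))) - c * c"
    unfolding iexp_difference_standardized_gaussian_process[OF M X kl]
      standardized_gaussian_process_moments(5)[OF X kl(1)]
      standardized_gaussian_process_moments(5)[OF X kl(2)]
    by (simp add: c_def)
  also have "c * c = exp (- u\<^sup>2)"
    unfolding c_def of_real_mult[symmetric] exp_add[symmetric] by simp
  finally show "(CLINT \<omega>|M. Y k \<omega> * cnj (Y l \<omega>)) =
      exp (- u\<^sup>2 * (1 - covariance M (X k) (X l))) - exp (- u\<^sup>2)"
    by simp
qed

text \<open>
  The covariance of the exponentials is \<open>exp (- u\<^sup>2 * (1 - r)) - exp (- u\<^sup>2)\<close> with correlation \<open>r \<le> 1\<close>.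
  Both exponents are nonpositive, and \<open>exp\<close> is \<open>1\<close>-Lipschitz and bounded by \<open>1\<close> there.
\<close>

lemma norm_iexp_covariance_le:
  fixes M :: "'a measure" and u :: real
  assumes M: "prob_space M" and X: "standardized_gaussian_process M X" and kl: "k \<ge> 1" "l \<ge> 1"
  defines "Y \<equiv> \<lambda>k \<omega>. iexp (u * X k \<omega>) - exp (- u\<^sup>2 / 2)"
  shows "norm (CLINT \<omega>|M. Y k \<omega> * cnj (Y l \<omega>)) \<le> 1"
    and "norm (CLINT \<omega>|M. Y k \<omega> * cnj (Y l \<omega>)) \<le> u\<^sup>2 * \<bar>covariance M (X k) (X l)\<bar>"
proof -
  define r where "r = covariance M (X k) (X l)"
  have r: "r \<le> 1"
    unfolding r_def by (rule standardized_gaussian_process_covariance_le_1[OF X kl])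
  have eq: "norm (CLINT \<omega>|M. Y k \<omega> * cnj (Y l \<omega>)) = \<bar>exp (- u\<^sup>2 * (1 - r)) - exp (- u\<^sup>2)\<bar>"
    unfolding Y_def iexp_covariance_standardized_gaussian_process(2)[OF M X kl] r_def
    by (metis norm_of_real of_real_diff)
  have *: "exp b - exp a \<le> b - a" if "a \<le> b" "b \<le> 0" for a b :: real
  proof -
    have "exp b - exp a = exp b * (1 - exp (a - b))"
      by (simp add: exp_diff field_simps)
    also have "\<dots> \<le> 1 * (b - a)"
    proof (rule mult_mono)
      show "1 - exp (a - b) \<le> b - a"
        using exp_ge_add_one_self[of "a - b"] by linarith
    qed (use that in auto)
    finally show ?thesis by simp
  qed
  have 1: "- u\<^sup>2 * (1 - r) \<le> 0" "- u\<^sup>2 \<le> 0"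
    using r by (auto simp: mult_nonneg_nonneg)
  then have "exp (- u\<^sup>2 * (1 - r)) \<le> 1" "exp (- u\<^sup>2) \<le> 1"
    by (auto simp del: mult_minus_left)
  moreover have "0 < exp (- u\<^sup>2 * (1 - r))" "0 < exp (- u\<^sup>2)"
    by auto
  ultimately show "norm (CLINT \<omega>|M. Y k \<omega> * cnj (Y l \<omega>)) \<le> 1"
    unfolding eq by linarith
  have "\<bar>exp (- u\<^sup>2 * (1 - r)) - exp (- u\<^sup>2)\<bar> \<le> \<bar>- u\<^sup>2 * (1 - r) - (- u\<^sup>2)\<bar>"
  proof (cases "- u\<^sup>2 \<le> - u\<^sup>2 * (1 - r)")
    case True
    then have "exp (- u\<^sup>2) \<le> exp (- u\<^sup>2 * (1 - r))"
      by (simp only: exp_le_cancel_iff)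
    with *[OF True 1(1)] True show ?thesis
      by linarith
  next
    case False
    then have le: "- u\<^sup>2 * (1 - r) \<le> - u\<^sup>2"
      by linarith
    then have "exp (- u\<^sup>2 * (1 - r)) \<le> exp (- u\<^sup>2)"
      by (simp only: exp_le_cancel_iff)
    with *[OF le 1(2)] le show ?thesis
      by linarith
  qed
  also have "- u\<^sup>2 * (1 - r) - (- u\<^sup>2) = u\<^sup>2 * r"
    by (simp add: algebra_simps)
  finally show "norm (CLINT \<omega>|M. Y k \<omega> * cnj (Y l \<omega>)) \<le> u\<^sup>2 * \<bar>covariance M (X k) (X l)\<bar>"
    unfolding eq by (simp add: r_def abs_mult)
qed

section \<open>Second moments of centered exponential sums\<close>

lemma sum_off_diagonal:
  fixes f :: "nat \<Rightarrow> nat \<Rightarrow> real"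
  assumes "\<And>i j. f i j = f j i"
  shows "(\<Sum>i\<in>{1..n}. \<Sum>j\<in>{1..n} - {i}. f i j) = 2 * (\<Sum>(i, j)\<in>{(i, j). 1 \<le> i \<and> i < j \<and> j \<le> n}. f i j)"
proof -
  define U where "U = {(i, j). 1 \<le> i \<and> i < j \<and> j \<le> n}"
  define V where "V = {(j, i). 1 \<le> i \<and> i < j \<and> j \<le> n}"
  have "U \<subseteq> {1..n} \<times> {1..n}" "V \<subseteq> {1..n} \<times> {1..n}"
    by (auto simp: U_def V_def)
  then have fin: "finite U" "finite V"
    by (auto intro: finite_subset)
  have "(\<Sum>i\<in>{1..n}. \<Sum>j\<in>{1..n} - {i}. f i j) = (\<Sum>(i, j)\<in>(SIGMA i:{1..n}. {1..n} - {i}). f i j)"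
    by (simp add: sum.Sigma)
  also have "(SIGMA i:{1..n}. {1..n} - {i}) = U \<union> V"
    by (auto simp: U_def V_def)
  also have "(\<Sum>(i, j)\<in>U \<union> V. f i j) = (\<Sum>(i, j)\<in>U. f i j) + (\<Sum>(i, j)\<in>V. f i j)"
    using fin by (intro sum.union_disjoint) (auto simp: U_def V_def)
  also have "(\<Sum>(i, j)\<in>V. f i j) = (\<Sum>(i, j)\<in>U. f i j)"
    by (rule sum.reindex_bij_witness[of _ prod.swap prod.swap])
      (auto simp: U_def V_def intro: assms)
  finally show ?thesis
    by (simp add: U_def)
qed

text \<open>
  Expanding the square gives a double sum of covariances. The diagonal terms are bounded by \<open>1\<close> each
  and add up to at most \<open>n\<close>; the off-diagonal terms are controlled by the correlations, whose absolute
  values add up to the dependence measure.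
\<close>

lemma second_moment_sum_iexp_le:
  fixes M :: "'a measure" and u :: real
  assumes M: "prob_space M" and X: "standardized_gaussian_process M X"
  defines "Y \<equiv> \<lambda>k \<omega>. iexp (u * X k \<omega>) - exp (- u\<^sup>2 / 2)"
  shows "integrable M (\<lambda>\<omega>. (norm (\<Sum>k=1..n. Y k \<omega>))\<^sup>2)"
    and "(\<integral>\<omega>. (norm (\<Sum>k=1..n. Y k \<omega>))\<^sup>2 \<partial>M) \<le> real n + u\<^sup>2 * dependence_measure M X n"
proof -
  have int: "integrable M (\<lambda>\<omega>. Y k \<omega> * cnj (Y l \<omega>))" if "k \<ge> 1" "l \<ge> 1" for k l
    unfolding Y_def by (rule iexp_covariance_standardized_gaussian_process(1)[OF M X that])
  have expand: "complex_of_real ((norm (\<Sum>k=1..n. Y k \<omega>))\<^sup>2) =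
      (\<Sum>k=1..n. \<Sum>l=1..n. Y k \<omega> * cnj (Y l \<omega>))" for \<omega>
    by (simp only: complex_norm_square cnj_sum sum_product)
  have ints: "integrable M (\<lambda>\<omega>. \<Sum>l=1..n. Y k \<omega> * cnj (Y l \<omega>))" if "k \<ge> 1" for k
    using that by (intro Bochner_Integration.integrable_sum int) auto
  have "integrable M (\<lambda>\<omega>. complex_of_real ((norm (\<Sum>k=1..n. Y k \<omega>))\<^sup>2))"
    unfolding expand by (intro Bochner_Integration.integrable_sum ints) auto
  then show "integrable M (\<lambda>\<omega>. (norm (\<Sum>k=1..n. Y k \<omega>))\<^sup>2)"
    using complex_of_real_integrable_eq by blast
  define g where "g k l = norm (CLINT \<omega>|M. Y k \<omega> * cnj (Y l \<omega>))" for k l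
  have g: "g k l \<le> 1" "g k l \<le> u\<^sup>2 * \<bar>covariance M (X k) (X l)\<bar>" if "k \<ge> 1" "l \<ge> 1" for k l
    using norm_iexp_covariance_le[OF M X that, of u] unfolding g_def Y_def by auto
  have "(CLINT \<omega>|M. complex_of_real ((norm (\<Sum>k=1..n. Y k \<omega>))\<^sup>2)) =
      (\<Sum>k=1..n. CLINT \<omega>|M. \<Sum>l=1..n. Y k \<omega> * cnj (Y l \<omega>))"
    unfolding expand by (intro Bochner_Integration.integral_sum ints) auto
  also have "\<dots> = (\<Sum>k=1..n. \<Sum>l=1..n. CLINT \<omega>|M. Y k \<omega> * cnj (Y l \<omega>))"
    by (intro sum.cong refl Bochner_Integration.integral_sum int) auto
  finally have "norm (CLINT \<omega>|M. complex_of_real ((norm (\<Sum>k=1..n. Y k \<omega>))\<^sup>2)) =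
      norm (\<Sum>k=1..n. \<Sum>l=1..n. CLINT \<omega>|M. Y k \<omega> * cnj (Y l \<omega>))"
    by (rule arg_cong)
  also have "\<dots> \<le> (\<Sum>k=1..n. \<Sum>l=1..n. g k l)"
    unfolding g_def by (intro order_trans[OF norm_sum] sum_mono norm_sum)
  also have "\<dots> \<le> (\<Sum>k=1..n. 1 + (\<Sum>l\<in>{1..n} - {k}. u\<^sup>2 * \<bar>covariance M (X k) (X l)\<bar>))"
  proof (rule sum_mono)
    fix k assume k: "k \<in> {1..n}"
    have "(\<Sum>l=1..n. g k l) = g k k + (\<Sum>l\<in>{1..n} - {k}. g k l)"
      using k by (simp add: sum.remove)
    also have "\<dots> \<le> 1 + (\<Sum>l\<in>{1..n} - {k}. u\<^sup>2 * \<bar>covariance M (X k) (X l)\<bar>)"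
      using k g by (intro add_mono sum_mono) auto
    finally show "(\<Sum>l=1..n. g k l) \<le> 1 + (\<Sum>l\<in>{1..n} - {k}. u\<^sup>2 * \<bar>covariance M (X k) (X l)\<bar>)" .
  qed
  also have "\<dots> = real n + u\<^sup>2 * (\<Sum>k=1..n. \<Sum>l\<in>{1..n} - {k}. \<bar>covariance M (X k) (X l)\<bar>)"
    by (simp add: sum.distrib sum_distrib_left)
  also have "(\<Sum>k=1..n. \<Sum>l\<in>{1..n} - {k}. \<bar>covariance M (X k) (X l)\<bar>) = dependence_measure M X n"
    unfolding dependence_measure_def
    by (rule sum_off_diagonal) (simp add: covariance_def mult.commute)
  finally show "(\<integral>\<omega>. (norm (\<Sum>k=1..n. Y k \<omega>))\<^sup>2 \<partial>M) \<le> real n + u\<^sup>2 * dependence_measure M X n"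
    unfolding integral_complex_of_real norm_of_real by linarith
qed


section \<open>From second moments to almost sure convergence\<close>

text \<open>
  By monotone convergence the pointwise sum of the \<open>f i\<close> has finite integral, so it is almost surely
  finite, and the terms of a convergent series tend to zero.
\<close>

lemma AE_tendsto_0_if_summable_integral:
  fixes f :: "nat \<Rightarrow> 'a \<Rightarrow> real"
  assumes int: "\<And>i. integrable M (f i)" and nonneg: "\<And>i \<omega>. 0 \<le> f i \<omega>"
    and sum: "summable (\<lambda>i. \<integral>\<omega>. f i \<omega> \<partial>M)"
  shows "AE \<omega> in M. (\<lambda>i. f i \<omega>) \<longlonglongrightarrow> 0"
proof -
  have [measurable]: "f i \<in> borel_measurable M" for i
    using int by auto
  have "(\<integral>\<^sup>+\<omega>. (\<Sum>i. ennreal (f i \<omega>)) \<partial>M) = (\<Sum>i. \<integral>\<^sup>+\<omega>. ennreal (f i \<omega>) \<partial>M)"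
    by (intro nn_integral_suminf) measurable
  also have "\<dots> = (\<Sum>i. ennreal (\<integral>\<omega>. f i \<omega> \<partial>M))"
    using int nonneg by (simp add: nn_integral_eq_integral)
  also have "\<dots> = ennreal (\<Sum>i. \<integral>\<omega>. f i \<omega> \<partial>M)"
    using sum nonneg by (intro suminf_ennreal2) auto
  finally have "(\<integral>\<^sup>+\<omega>. (\<Sum>i. ennreal (f i \<omega>)) \<partial>M) \<noteq> \<infinity>"
    by simp
  then have "AE \<omega> in M. (\<Sum>i. ennreal (f i \<omega>)) \<noteq> \<infinity>"
    by (intro nn_integral_PInf_AE) auto
  then show ?thesis
  proof eventually_elim
    case (elim \<omega>)
    then have "summable (\<lambda>i. f i \<omega>)"
      using nonneg by (intro summable_suminf_not_top) (auto simp: top_ennreal_def)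
    then show ?case
      by (rule summable_LIMSEQ_zero)
  qed
qed

text \<open>
  Every \<open>n\<close> lies between consecutive powers \<open>g\<close> and \<open>\<gamma> * g\<close>. Passing from \<open>\<lfloor>g\<rfloor>\<close> to \<open>n\<close> adds at most
  \<open>(\<gamma> - 1) * n + 1\<close> terms of norm at most \<open>B\<close>, which changes the average by little more than
  \<open>B * (\<gamma> - 1)\<close>. Letting \<open>\<gamma>\<close> decrease to \<open>1\<close> along \<open>1 + 1 / Suc m\<close> makes this negligible, and only
  countably many \<open>\<gamma>\<close> are involved, as almost sure statements require.
\<close>

lemma averages_tendsto_0_if_geometric_subsequences:
  fixes y :: "nat \<Rightarrow> 'b::real_normed_vector"
  assumes bound: "\<And>k. norm (y k) \<le> B"
    and sub: "\<And>m. (\<lambda>i. norm (\<Sum>k=1..nat \<lfloor>(1 + 1 / real (Suc m)) ^ Suc i\<rfloor>. y k) /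
      real (nat \<lfloor>(1 + 1 / real (Suc m)) ^ Suc i\<rfloor>)) \<longlonglongrightarrow> 0"
  shows "(\<lambda>n. norm (\<Sum>k=1..n. y k) / real n) \<longlonglongrightarrow> 0"
proof (rule LIMSEQ_I)
  fix \<epsilon> :: real assume \<epsilon>: "\<epsilon> > 0"
  define s where "s n = (\<Sum>k=1..n. y k)" for n
  have B: "0 \<le> B"
    using bound[of 0] norm_ge_zero[of "y 0"] by linarith
  have inv0: "(\<lambda>n. B / real n) \<longlonglongrightarrow> 0"
    by (rule lim_const_over_n)
  then have "eventually (\<lambda>m. B / real m < \<epsilon> / 3) sequentially"
    using \<epsilon> by (intro order_tendstoD) auto
  then obtain m0 where m0: "\<And>m. m \<ge> m0 \<Longrightarrow> B / real m < \<epsilon> / 3"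
    by (auto simp: eventually_sequentially)
  define m where "m = m0"
  define \<gamma> where "\<gamma> = 1 + 1 / real (Suc m)"
  have \<gamma>: "\<gamma> > 1" and B\<gamma>: "B * (\<gamma> - 1) < \<epsilon> / 3"
    using m0[of "Suc m"] by (auto simp: \<gamma>_def m_def)
  define N where "N i = nat \<lfloor>\<gamma> ^ Suc i\<rfloor>" for i
  have "eventually (\<lambda>i. norm (s (N i)) / real (N i) < \<epsilon> / 3) sequentially"
    using sub[of m] \<epsilon> unfolding s_def N_def \<gamma>_def by (intro order_tendstoD(2)) auto
  then obtain i0 where i0: "\<And>i. i \<ge> i0 \<Longrightarrow> norm (s (N i)) / real (N i) < \<epsilon> / 3"
    by (auto simp: eventually_sequentially)
  show "\<exists>n0. \<forall>n\<ge>n0. norm (norm (\<Sum>k=1..n. y k) / real n - 0) < \<epsilon>"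
  proof (intro exI allI impI)
    fix n assume n: "n \<ge> max m0 (nat \<lceil>\<gamma> ^ Suc i0\<rceil>)"
    have n1: "\<gamma> ^ Suc i0 \<le> real n"
      using n by linarith
    \<comment> \<open>The least power exceeding \<open>n\<close> is \<open>\<gamma> ^ Suc (Suc i)\<close>, where \<open>i\<close> is at least \<open>i0\<close>.\<close>
    define j where "j = (LEAST j. real n < \<gamma> ^ j)"
    have j: "real n < \<gamma> ^ j"
      unfolding j_def using real_arch_pow[OF \<gamma>, of "real n"] by (rule LeastI_ex)
    have j_min: "\<gamma> ^ i \<le> real n" if "i < j" for i
      using not_less_Least[OF that[unfolded j_def]] by simp
    have "Suc i0 < j"
    proof (rule ccontr)
      assume "\<not> Suc i0 < j"
      then have "\<gamma> ^ j \<le> \<gamma> ^ Suc i0"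
        using \<gamma> by (intro power_increasing) auto
      with j n1 show False by linarith
    qed
    moreover define i where "i = j - 2"
    ultimately have i: "j = Suc (Suc i)" "i \<ge> i0"
      by simp_all
    define g where "g = \<gamma> ^ Suc i"
    have g: "1 \<le> g" "g \<le> real n" "real n < \<gamma> * g"
      using j j_min[of "Suc i"] \<gamma> i one_le_power[of \<gamma> "Suc i"] by (auto simp: g_def)
    have N: "1 \<le> N i" "N i \<le> n" "g < real (N i) + 1"
      using g unfolding N_def g_def[symmetric] by linarith+
    have "real n - real (N i) \<le> (\<gamma> - 1) * real n + 1"
    proof -
      have "\<gamma> * g - g = (\<gamma> - 1) * g"
        by (simp add: algebra_simps)
      also have "\<dots> \<le> (\<gamma> - 1) * real n"
        using g \<gamma> by (intro mult_left_mono) auto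
      finally show ?thesis
        using g N by linarith
    qed
    then have gap: "B * (real n - real (N i)) \<le> B * (\<gamma> - 1) * real n + B"
      using mult_left_mono[OF _ B] by (fastforce simp: algebra_simps)
    have "s n = s (N i) + (\<Sum>k\<in>{N i<..n}. y k)"
    proof -
      have "{1..n} = {1..N i} \<union> {N i<..n}"
        using N by auto
      then show ?thesis
        unfolding s_def by (simp only:) (rule sum.union_disjoint, auto)
    qed
    moreover have "norm (\<Sum>k\<in>{N i<..n}. y k) \<le> B * (real n - real (N i))"
      using sum_norm_bound[of "{N i<..n}" y B] bound N by (simp add: mult.commute of_nat_diff)
    ultimately have "norm (s n) \<le> norm (s (N i)) + (B * (\<gamma> - 1) * real n + B)"
      using norm_triangle_ineq[of "s (N i)" "\<Sum>k\<in>{N i<..n}. y k"] gap by simp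
    then have "norm (s n) / real n \<le> (norm (s (N i)) + (B * (\<gamma> - 1) * real n + B)) / real n"
      by (rule divide_right_mono) simp
    also have "\<dots> = norm (s (N i)) / real n + B * (\<gamma> - 1) + B / real n"
      using N by (simp add: add_divide_distrib)
    also have "norm (s (N i)) / real n \<le> norm (s (N i)) / real (N i)"
      using N by (intro divide_left_mono) auto
    finally have "norm (s n) / real n \<le> norm (s (N i)) / real (N i) + B * (\<gamma> - 1) + B / real n"
      by simp
    moreover have "B / real n < \<epsilon> / 3"
      using m0[of n] n by simp
    ultimately have "norm (s n) / real n < \<epsilon>"
      using i0[OF i(2)] B\<gamma> by linarith
    then show "norm (norm (\<Sum>k=1..n. y k) / real n - 0) < \<epsilon>"
      by (simp add: s_def)
  qed
qed

lemma dependence_measure_nonneg: "0 \<le> dependence_measure M X n"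
  by (auto simp: dependence_measure_def intro!: sum_nonneg)

text \<open>
  The cube roots tend to zero, so eventually they are at most \<open>1\<close>, and \<open>r ^ 3 \<le> r\<close> for \<open>r\<close> in \<open>[0, 1]\<close>.
\<close>

lemma summable_if_summable_root3:
  fixes d :: "nat \<Rightarrow> real"
  assumes nonneg: "\<And>i. 0 \<le> d i" and root: "summable (\<lambda>i. root 3 (d i))"
  shows "summable d"
proof (rule summable_comparison_test_ev[OF _ root])
  have "eventually (\<lambda>i. root 3 (d i) < 1) sequentially"
    using summable_LIMSEQ_zero[OF root] by (rule order_tendstoD) simp
  then show "eventually (\<lambda>i. norm (d i) \<le> root 3 (d i)) sequentially"
  proof eventually_elim
    case (elim i)
    define r where "r = root 3 (d i)"
    have r: "0 \<le> r" "r \<le> 1" "d i = r ^ 3"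
      using elim nonneg[of i] by (auto simp: r_def)
    have "r ^ 3 \<le> r ^ 1"
      using r by (intro power_decreasing) auto
    then show ?case
      using r(3) nonneg[of i] unfolding r_def[symmetric] by simp
  qed
qed

text \<open>
  The second moment of the average over \<open>n\<close> terms is at most \<open>1 / n + u\<^sup>2 * \<Delta>(n) / n\<^sup>2\<close>. Along
  \<open>n = \<lfloor>\<gamma> ^ i\<rfloor>\<close> the first part is dominated by a geometric series and the second is summable by
  hypothesis.
\<close>

lemma AE_centered_iexp_averages_tendsto_0:
  fixes M :: "'a measure" and u :: real
  assumes M: "prob_space M" and X: "standardized_gaussian_process M X"
    and dep: "\<And>\<gamma>::real. \<gamma> > 1 \<Longrightarrow>
      summable (\<lambda>i. root 3 (dependence_measure M X (nat \<lfloor>\<gamma> ^ Suc i\<rfloor>) / (real_of_int \<lfloor>\<gamma> ^ Suc i\<rfloor>)\<^sup>2))"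
  defines "Y \<equiv> \<lambda>k \<omega>. iexp (u * X k \<omega>) - exp (- u\<^sup>2 / 2)"
  shows "AE \<omega> in M. (\<lambda>n. norm (\<Sum>k=1..n. Y k \<omega>) / real n) \<longlonglongrightarrow> 0"
proof -
  define S where "S n \<omega> = norm (\<Sum>k=1..n. Y k \<omega>) / real n" for n \<omega>
  have int: "integrable M (\<lambda>\<omega>. (S n \<omega>)\<^sup>2)" for n
    using second_moment_sum_iexp_le(1)[OF M X, where n = n and u = u]
    by (simp add: S_def Y_def power_divide)
  have second_moment: "(\<integral>\<omega>. (S n \<omega>)\<^sup>2 \<partial>M) \<le> 1 / real n + u\<^sup>2 * (dependence_measure M X n / (real n)\<^sup>2)" for n
  proof -
    have "(\<integral>\<omega>. (S n \<omega>)\<^sup>2 \<partial>M) = (\<integral>\<omega>. (norm (\<Sum>k=1..n. Y k \<omega>))\<^sup>2 \<partial>M) / (real n)\<^sup>2"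
      by (simp add: S_def power_divide)
    also have "\<dots> \<le> (real n + u\<^sup>2 * dependence_measure M X n) / (real n)\<^sup>2"
      using second_moment_sum_iexp_le(2)[OF M X, where n = n and u = u] unfolding Y_def
      by (intro divide_right_mono) auto
    also have "\<dots> = 1 / real n + u\<^sup>2 * (dependence_measure M X n / (real n)\<^sup>2)"
      by (simp add: add_divide_distrib power2_eq_square)
    finally show ?thesis .
  qed
  have sub: "AE \<omega> in M. (\<lambda>i. S (nat \<lfloor>\<gamma> ^ Suc i\<rfloor>) \<omega>) \<longlonglongrightarrow> 0" if \<gamma>: "\<gamma> > 1" for \<gamma> :: real
  proof -
    define N where "N i = nat \<lfloor>\<gamma> ^ Suc i\<rfloor>" for i
    have ge1: "1 \<le> \<gamma> ^ Suc i" for i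
      using \<gamma> by (intro one_le_power) simp
    have floor: "real_of_int \<lfloor>x\<rfloor> = real (nat \<lfloor>x\<rfloor>)" "x / 2 \<le> real (nat \<lfloor>x\<rfloor>)"
      if "1 \<le> x" for x :: real
    proof -
      have "1 \<le> nat \<lfloor>x\<rfloor>" "x < real (nat \<lfloor>x\<rfloor>) + 1"
        using that by linarith+
      then show "x / 2 \<le> real (nat \<lfloor>x\<rfloor>)"
        by linarith
    qed (use that in simp)
    have N: "real_of_int \<lfloor>\<gamma> ^ Suc i\<rfloor> = real (N i)" "\<gamma> ^ Suc i / 2 \<le> real (N i)" for i
      unfolding N_def using floor[OF ge1[of i]] by blast+
    have "summable (\<lambda>i. root 3 (dependence_measure M X (N i) / (real (N i))\<^sup>2))"
      using dep[OF \<gamma>] unfolding N(1) unfolding N_def .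
    then have sum1: "summable (\<lambda>i. dependence_measure M X (N i) / (real (N i))\<^sup>2)"
      by (rule summable_if_summable_root3[rotated]) (simp add: dependence_measure_nonneg)
    have geom: "summable (\<lambda>i. 2 / \<gamma> * (1 / \<gamma>) ^ i)"
      using \<gamma> by (intro summable_mult summable_geometric) simp
    have sum2: "summable (\<lambda>i. 1 / real (N i))"
    proof (rule summable_comparison_test'[OF geom])
      fix i
      have "1 / real (N i) \<le> 1 / (\<gamma> ^ Suc i / 2)"
        using N(2)[of i] ge1[of i] by (intro divide_left_mono) auto
      then show "norm (1 / real (N i)) \<le> 2 / \<gamma> * (1 / \<gamma>) ^ i"
        by (simp add: power_one_over)
    qed
    have "summable (\<lambda>i. \<integral>\<omega>. (S (N i) \<omega>)\<^sup>2 \<partial>M)"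
    proof (rule summable_comparison_test')
      show "summable (\<lambda>i. 1 / real (N i) + u\<^sup>2 * (dependence_measure M X (N i) / (real (N i))\<^sup>2))"
        by (intro summable_add summable_mult sum1 sum2)
      show "norm (\<integral>\<omega>. (S (N i) \<omega>)\<^sup>2 \<partial>M) \<le>
          1 / real (N i) + u\<^sup>2 * (dependence_measure M X (N i) / (real (N i))\<^sup>2)" for i
        using second_moment[of "N i"] by simp
    qed
    then have "AE \<omega> in M. (\<lambda>i. (S (N i) \<omega>)\<^sup>2) \<longlonglongrightarrow> 0"
      using int by (intro AE_tendsto_0_if_summable_integral) auto
    then show ?thesis
    proof eventually_elim
      case (elim \<omega>)
      from tendsto_real_sqrt[OF elim] show ?case
        by (simp add: N_def S_def)
    qed
  qed
  have "AE \<omega> in M. \<forall>m. (\<lambda>i. S (nat \<lfloor>(1 + 1 / real (Suc m)) ^ Suc i\<rfloor>) \<omega>) \<longlonglongrightarrow> 0"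
    unfolding AE_all_countable by (intro allI sub) simp
  then show ?thesis
  proof eventually_elim
    case (elim \<omega>)
    show ?case
    proof (rule averages_tendsto_0_if_geometric_subsequences)
      fix k
      have "norm (Y k \<omega>) \<le> norm (iexp (u * X k \<omega>)) + norm (complex_of_real (exp (- u\<^sup>2 / 2)))"
        unfolding Y_def by (rule norm_triangle_ineq4)
      also have "\<dots> \<le> 1 + 1"
        by (intro add_mono) (simp_all del: of_real_mult)
      finally show "norm (Y k \<omega>) \<le> 2"
        by simp
    qed (use elim in \<open>auto simp: S_def\<close>)
  qed
qed


section \<open>From almost every argument of the characteristic function to all\<close>

text \<open>
  Bound the difference by the expectation of \<open>norm (iexp ((u - v) * x) - 1)\<close>, then apply
  Cauchy--Schwarz; the square of this norm is \<open>2 * (1 - cos ((u - v) * x))\<close>. The inequality controls the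
  oscillation of a characteristic function near any point by a single value close to the origin.
\<close>

lemma (in real_distribution) norm_char_diff_le:
  "norm (char M u - char M v) \<le> sqrt (2 * (1 - Re (char M (u - v))))"
proof -
  define d where "d x = iexp ((u - v) * x) - 1" for x
  have int_iexp: "integrable M (\<lambda>x. iexp (t * x))" for t
    by (rule integrable_iexp) auto
  have d_norm_sq: "(norm (d x))\<^sup>2 = 2 * (1 - Re (iexp ((u - v) * x)))" for x
  proof -
    have "(cos y - 1)\<^sup>2 + (sin y)\<^sup>2 = 2 * (1 - cos y)" for y :: real
      using sin_cos_squared_add[of y] by (simp add: power2_diff)
    then show ?thesis
      unfolding d_def cmod_power2 by (simp add: Re_exp Im_exp)
  qed
  have int_d: "integrable M d"
    unfolding d_def by (intro Bochner_Integration.integrable_diff int_iexp integrable_const)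
  have int_d2: "integrable M (\<lambda>x. (norm (d x))\<^sup>2)"
    unfolding d_norm_sq using int_iexp[of "u - v"] by (simp del: of_real_mult)
  have E_d2: "(\<integral>x. (norm (d x))\<^sup>2 \<partial>M) = 2 * (1 - Re (char M (u - v)))"
    unfolding d_norm_sq char_def using int_iexp[of "u - v"] prob_space
    by (simp del: of_real_mult space_eq_univ)
  have "char M u - char M v = (CLINT x|M. iexp (u * x) - iexp (v * x))"
    unfolding char_def by (rule Bochner_Integration.integral_diff[symmetric]) (rule int_iexp)+
  also have "\<dots> = (CLINT x|M. iexp (v * x) * d x)"
    by (simp add: d_def algebra_simps exp_add[symmetric])
  finally have "norm (char M u - char M v) \<le> (\<integral>x. norm (iexp (v * x) * d x) \<partial>M)"
    by simp
  also have "\<dots> = expectation (\<lambda>x. norm (d x))"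
    by (simp add: norm_mult del: of_real_mult)
  also have "\<dots> \<le> sqrt (\<integral>x. (norm (d x))\<^sup>2 \<partial>M)"
  proof (rule real_le_rsqrt)
    show "(expectation (\<lambda>x. norm (d x)))\<^sup>2 \<le> (\<integral>x. (norm (d x))\<^sup>2 \<partial>M)"
      using variance_eq[of "\<lambda>x. norm (d x)"] variance_positive[of "\<lambda>x. norm (d x)"] int_d int_d2
      by simp
  qed
  finally show ?thesis
    unfolding E_d2 .
qed

lemma ex_in_interval_AE_lborel:
  fixes a b :: real
  assumes "AE x in lborel. P x" "a < b"
  obtains x where "a < x" "x < b" "P x"
proof (rule ccontr)
  assume "\<not> thesis"
  then have "\<not> P x" if "x \<in> {a<..<b}" for x
    using that \<open>\<And>x. \<lbrakk>a < x; x < b; P x\<rbrakk> \<Longrightarrow> thesis\<close> by auto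
  with assms(1) have "AE x in lborel. x \<notin> {a<..<b}"
    by (auto elim: eventually_mono)
  then have "emeasure lborel {a<..<b} = 0"
    by (subst (asm) AE_iff_measurable[of "{a<..<b}"]) auto
  with \<open>a < b\<close> show False
    by simp
qed

text \<open>
  Almost every \<open>v\<close> is good, in the sense that convergence holds at \<open>v\<close> and at \<open>u - v\<close>. Take such a \<open>v\<close>
  near \<open>u\<close>: convergence at \<open>v\<close> carries over to \<open>u\<close>, because convergence at \<open>u - v\<close> together with the
  oscillation inequality bounds \<open>char (\<mu> n) u - char (\<mu> n) v\<close> for all large \<open>n\<close>.
\<close>

lemma char_tendsto_if_AE_char_tendsto:
  fixes \<mu> :: "nat \<Rightarrow> real measure"
  assumes \<mu>: "\<And>n. real_distribution (\<mu> n)" and \<nu>: "real_distribution \<nu>"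
    and AE: "AE u in lborel. (\<lambda>n. char (\<mu> n) u) \<longlonglongrightarrow> char \<nu> u"
  shows "(\<lambda>n. char (\<mu> n) u) \<longlonglongrightarrow> char \<nu> u"
proof -
  interpret \<mu>: real_distribution "\<mu> n" for n by (rule \<mu>)
  interpret \<nu>: real_distribution \<nu> by (rule \<nu>)
  define P where "P v \<longleftrightarrow> (\<lambda>n. norm (char (\<mu> n) v - char \<nu> v)) \<longlonglongrightarrow> 0" for v
  have P_iff: "P v \<longleftrightarrow> (\<lambda>n. char (\<mu> n) v) \<longlonglongrightarrow> char \<nu> v" for v
    unfolding P_def by (subst tendsto_norm_zero_iff) (rule LIM_zero_iff)
  have "Measurable.pred borel P"
    unfolding P_def by measurable
  moreover have AE_P: "AE v in lborel. P v"
    using AE by (simp add: P_iff)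
  \<comment> \<open>Lebesgue measure is invariant under the reflection \<open>v \<mapsto> u - v\<close>.\<close>
  ultimately have "AE v in lborel. P (u + (- 1) * v)"
    by (intro AE_borel_affine) auto
  with AE_P have AE_both: "AE v in lborel. P v \<and> P (u - v)"
    by eventually_elim simp
  show ?thesis
  proof (rule metric_LIMSEQ_I)
    fix \<epsilon> :: real assume \<epsilon>: "\<epsilon> > 0"
    define h where "h \<kappa> w = sqrt (2 * (1 - Re (char \<kappa> w)))" for \<kappa> w
    have "isCont (h \<nu>) 0"
      unfolding h_def by (intro continuous_intros isCont_Re \<nu>.isCont_char)
    moreover have "h \<nu> 0 = 0"
      by (simp add: h_def \<nu>.char_zero)
    ultimately obtain \<delta> where \<delta>: "\<delta> > 0" "\<And>w. \<bar>w\<bar> < \<delta> \<Longrightarrow> \<bar>h \<nu> w\<bar> < \<epsilon> / 3"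
      using \<epsilon> unfolding continuous_at_eps_delta
      by (metis diff_zero dist_real_def zero_less_divide_iff zero_less_numeral)
    obtain v where v: "u - \<delta> < v" "v < u + \<delta>" "P v" "P (u - v)"
      using ex_in_interval_AE_lborel[OF AE_both, of "u - \<delta>" "u + \<delta>"] \<delta>(1) by auto
    have h_small: "h \<nu> (u - v) < \<epsilon> / 3"
      using \<delta>(2)[of "u - v"] v by (simp add: abs_less_iff)
    have "(\<lambda>n. h (\<mu> n) (u - v)) \<longlonglongrightarrow> h \<nu> (u - v)"
      using v(4) unfolding h_def P_iff by (intro tendsto_intros)
    then have ev1: "\<forall>\<^sub>F n in sequentially. h (\<mu> n) (u - v) < \<epsilon> / 3"
      using h_small by (rule order_tendstoD(2))
    have ev2: "\<forall>\<^sub>F n in sequentially. norm (char (\<mu> n) v - char \<nu> v) < \<epsilon> / 3"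
      using v(3) \<epsilon> unfolding P_def by (intro order_tendstoD(2)) auto
    from ev1 ev2 have "\<forall>\<^sub>F n in sequentially. dist (char (\<mu> n) u) (char \<nu> u) < \<epsilon>"
    proof eventually_elim
      case (elim n)
      have "norm (char (\<mu> n) u - char (\<mu> n) v) < \<epsilon> / 3"
        using \<mu>.norm_char_diff_le[of n u v] elim(1) by (simp add: h_def)
      moreover have "norm (char \<nu> u - char \<nu> v) < \<epsilon> / 3"
        using \<nu>.norm_char_diff_le[of u v] h_small by (simp add: h_def)
      moreover have "norm (char (\<mu> n) u - char \<nu> u) \<le> norm (char (\<mu> n) u - char (\<mu> n) v)
          + norm (char (\<mu> n) v - char \<nu> v) + norm (char \<nu> u - char \<nu> v)"
        by norm
      ultimately show ?case
        using elim(2) unfolding dist_norm by linarith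
    qed
    then show "\<exists>n0. \<forall>n\<ge>n0. dist (char (\<mu> n) u) (char \<nu> u) < \<epsilon>"
      by (simp add: eventually_sequentially)
  qed
qed

section \<open>Weak convergence of the empirical measures\<close>

lemma isCont_std_normal_cdf: "isCont std_normal_cdf x"
proof -
  interpret real_distribution std_normal_distribution
    by (rule real_dist_normal_dist)
  have "AE y in lborel. y \<in> {x} \<longrightarrow> ennreal (std_normal_density y) = 0"
    using AE_lborel_singleton[of x] by eventually_elim simp
  then have "{x} \<in> null_sets std_normal_distribution"
    by (intro null_sets_density_iff[THEN iffD2] conjI) auto
  then show ?thesis
    unfolding std_normal_cdf_def isCont_cdf by (simp only: measure_def null_setsD1 enn2real_0)
qed

text \<open>
  The value at \<open>n = 0\<close> is an unspecified distribution. It keeps \<open>empirical_measure X n \<omega>\<close> a probability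
  measure for every \<open>n\<close>, as the continuity theorem demands of the whole sequence.
\<close>

definition empirical_measure :: "(nat \<Rightarrow> 'a \<Rightarrow> real) \<Rightarrow> nat \<Rightarrow> 'a \<Rightarrow> real measure" where
  "empirical_measure X n \<omega> = distr (measure_pmf (pmf_of_set {1..n})) borel (\<lambda>k. X k \<omega>)"

lemma real_distribution_empirical_measure: "real_distribution (empirical_measure X n \<omega>)"
  unfolding empirical_measure_def 
  by (rule prob_space.real_distribution_distr[OF prob_space_measure_pmf]) simp

lemma char_empirical_measure:
  assumes "n \<ge> 1"
  shows "char (empirical_measure X n \<omega>) u = (\<Sum>k=1..n. iexp (u * X k \<omega>)) / n"
proof -
  have "char (empirical_measure X n \<omega>) u =
      (CLINT k|measure_pmf (pmf_of_set {1..n}). iexp (u * X k \<omega>))"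
    unfolding char_def empirical_measure_def by (subst integral_distr) simp_all
  also have "\<dots> = (\<Sum>k=1..n. pmf (pmf_of_set {1..n}) k *\<^sub>R iexp (u * X k \<omega>))"
    using assms by (intro integral_measure_pmf) (auto simp: set_pmf_of_set)
  also have "\<dots> = (\<Sum>k=1..n. iexp (u * X k \<omega>) / n)"
    using assms by (intro sum.cong refl) (simp add: scaleR_conv_of_real divide_inverse mult.commute)
  finally show ?thesis
    by (simp only: sum_divide_distrib)
qed

lemma cdf_empirical_measure:
  assumes "n \<ge> 1"
  shows "cdf (empirical_measure X n \<omega>) x = (1 / real n) * (\<Sum>k=1..n. indicat_real {..x} (X k \<omega>))"
proof -
  have "cdf (empirical_measure X n \<omega>) x = real (card ({1..n} \<inter> {k. X k \<omega> \<le> x})) / real n"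
    using assms
    by (simp add: cdf_def empirical_measure_def measure_distr measure_pmf_of_set vimage_def)
  also have "real (card ({1..n} \<inter> {k. X k \<omega> \<le> x})) = (\<Sum>k=1..n. indicat_real {..x} (X k \<omega>))"
    by (simp add: indicator_def sum.If_cases Int_def)
  finally show ?thesis
    by simp
qed

text \<open>
  For each \<open>u\<close> the empirical characteristic functions converge at \<open>u\<close> outside a null set that depends
  on \<open>u\<close>. Fubini exchanges the quantifiers: almost surely they converge at almost every \<open>u\<close>, hence at
  every \<open>u\<close>, and the continuity theorem of Levy gives weak convergence to the standard normal law.
\<close>

lemma AE_cdf_empirical_measure_tendsto:
  fixes M :: "'a measure"
  assumes M: "prob_space M" and X: "standardized_gaussian_process M X"
    and dep: "\<And>\<gamma>::real. \<gamma> > 1 \<Longrightarrow>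
      summable (\<lambda>i. root 3 (dependence_measure M X (nat \<lfloor>\<gamma> ^ Suc i\<rfloor>) / (real_of_int \<lfloor>\<gamma> ^ Suc i\<rfloor>)\<^sup>2))"
  shows "AE \<omega> in M. \<forall>x. (\<lambda>n. cdf (empirical_measure X n \<omega>) x) \<longlonglongrightarrow> std_normal_cdf x"
proof -
  interpret prob_space M by fact
  interpret G: real_distribution std_normal_distribution
    by (rule real_dist_normal_dist)
  interpret pair_sigma_finite M "lborel :: real measure" ..
  define Q where "Q \<omega> u \<longleftrightarrow>
      (\<lambda>n. norm (\<Sum>k=1..n. iexp (u * X k \<omega>) - exp (- u\<^sup>2 / 2)) / real n) \<longlonglongrightarrow> 0" for \<omega> u
  have X_meas: "(\<lambda>p. X k (fst p)) \<in> borel_measurable (M \<Otimes>\<^sub>M lborel)" if "k \<ge> 1" for k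
    using measurable_compose[OF measurable_fst distr_standardized_gaussian_process(1)[OF X that]] .
  have Q_meas: "Measurable.pred (M \<Otimes>\<^sub>M lborel) (\<lambda>p. Q (fst p) (snd p))"
  proof -
    have "(\<lambda>p. iexp (snd p * X k (fst p)) - exp (- (snd p)\<^sup>2 / 2)) \<in> borel_measurable (M \<Otimes>\<^sub>M lborel)"
      if "k \<in> {1..n}" for k n
    proof -
      have [measurable]: "(\<lambda>p. X k (fst p)) \<in> borel_measurable (M \<Otimes>\<^sub>M lborel)"
        using that by (intro X_meas) simp
      show ?thesis
        by measurable
    qed
    then have [measurable]: "(\<lambda>p. \<Sum>k=1..n. iexp (snd p * X k (fst p)) - exp (- (snd p)\<^sup>2 / 2))
        \<in> borel_measurable (M \<Otimes>\<^sub>M lborel)" for n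
      by (rule borel_measurable_sum)
    show ?thesis
      unfolding Q_def by measurable
  qed
  have "AE u in lborel. AE \<omega> in M. Q \<omega> u"
    unfolding Q_def by (intro AE_I2 AE_centered_iexp_averages_tendsto_0[OF M X dep])
  then have "AE \<omega> in M. AE u in lborel. Q \<omega> u"
    using Q_meas by (subst AE_commute) (auto simp: pred_def)
  then show ?thesis
  proof eventually_elim
    case (elim \<omega>)
    have char_conv: "(\<lambda>n. char (empirical_measure X n \<omega>) u) \<longlonglongrightarrow> char std_normal_distribution u"
      if "Q \<omega> u" for u
    proof -
      have "\<forall>\<^sub>F n in sequentially. norm (\<Sum>k=1..n. iexp (u * X k \<omega>) - exp (- u\<^sup>2 / 2)) / real n =
          norm (char (empirical_measure X n \<omega>) u - char std_normal_distribution u)"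
        using eventually_ge_at_top[of 1]
      proof eventually_elim
        case (elim n)
        have "(\<Sum>k=1..n. iexp (u * X k \<omega>) - exp (- u\<^sup>2 / 2)) =
            (\<Sum>k=1..n. iexp (u * X k \<omega>)) - n * complex_of_real (exp (- u\<^sup>2 / 2))"
          by (simp only: sum_subtractf sum_constant card_atLeastAtMost) simp
        also have "\<dots> = n * (char (empirical_measure X n \<omega>) u - char std_normal_distribution u)"
          unfolding char_empirical_measure[OF elim] char_std_normal_distribution
          using elim by (simp add: right_diff_distrib del: of_real_mult)
        finally show ?case
          using elim by (simp add: norm_mult)
      qed
      with that show ?thesis
        unfolding Q_def
        by (subst (asm) tendsto_cong) (auto simp: tendsto_norm_zero_iff LIM_zero_iff)
    qed
    have "weak_conv_m (\<lambda>n. empirical_measure X n \<omega>) std_normal_distribution"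
    proof (rule levy_continuity)
      show "(\<lambda>n. char (empirical_measure X n \<omega>) u) \<longlonglongrightarrow> char std_normal_distribution u" for u
        using elim char_conv
        by (intro char_tendsto_if_AE_char_tendsto real_distribution_empirical_measure
            real_dist_normal_dist) (auto elim: eventually_mono)
    qed (rule real_distribution_empirical_measure real_dist_normal_dist)+
    moreover have "isCont (cdf std_normal_distribution) x" for x
      by (rule isCont_std_normal_cdf[unfolded std_normal_cdf_def])
    ultimately show ?case
      unfolding weak_conv_m_def weak_conv_def std_normal_cdf_def by blast
  qed
qed


section \<open>Uniform convergence of the empirical distribution functions\<close>

lemma strict_mono_std_normal_cdf: "strict_mono std_normal_cdf"
proof (rule strict_monoI)
  fix x y :: real assume xy: "x < y"
  interpret real_distribution std_normal_distribution
    by (rule real_dist_normal_dist)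
  have "{x<..y} \<notin> null_sets std_normal_distribution"
  proof
    assume "{x<..y} \<in> null_sets std_normal_distribution"
    then have "AE z in lborel. z \<in> {x<..y} \<longrightarrow> ennreal (std_normal_density z) = 0"
      by (subst (asm) null_sets_density_iff) auto
    then have "AE z in lborel. z \<notin> {x<..y}"
      by eventually_elim (auto simp: std_normal_density_def)
    from ex_in_interval_AE_lborel[OF this xy] show False
      by auto
  qed
  then have "0 < measure std_normal_distribution {x<..y}"
    by (simp add: null_sets_def emeasure_eq_measure zero_less_measure_iff)
  moreover have "std_normal_cdf y - std_normal_cdf x = measure std_normal_distribution {x<..y}"
    unfolding std_normal_cdf_def by (rule cdf_diff_eq[OF xy])
  ultimately show "std_normal_cdf x < std_normal_cdf y"
    by linarith
qed

lemma std_normal_cdf_le_iff: "std_normal_cdf x \<le> std_normal_cdf y \<longleftrightarrow> x \<le> y"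
  by (rule strict_mono_less_eq[OF strict_mono_std_normal_cdf])

lemma std_normal_cdf_bounds: "0 < std_normal_cdf x" "std_normal_cdf x < 1"
proof -
  interpret real_distribution std_normal_distribution
    by (rule real_dist_normal_dist)
  have "0 \<le> std_normal_cdf (x - 1)" "std_normal_cdf (x + 1) \<le> 1"
    unfolding std_normal_cdf_def by (rule cdf_nonneg, rule cdf_bounded_prob)
  moreover have "std_normal_cdf (x - 1) < std_normal_cdf x" "std_normal_cdf x < std_normal_cdf (x + 1)"
    by (simp_all add: strict_mono_less[OF strict_mono_std_normal_cdf])
  ultimately show "0 < std_normal_cdf x" "std_normal_cdf x < 1"
    by linarith+
qed

lemma ex_std_normal_cdf_eq:
  assumes "0 < t" "t < 1"
  obtains x where "std_normal_cdf x = t"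
proof -
  interpret real_distribution std_normal_distribution
    by (rule real_dist_normal_dist)
  have "\<forall>\<^sub>F x in at_bot. std_normal_cdf x < t"
    unfolding std_normal_cdf_def using cdf_lim_at_bot assms(1) by (rule order_tendstoD)
  then obtain a where a: "std_normal_cdf a < t"
    by (auto simp: eventually_at_bot_linorder)
  have "\<forall>\<^sub>F x in at_top. t < std_normal_cdf x"
    unfolding std_normal_cdf_def using cdf_lim_at_top_prob assms(2) by (rule order_tendstoD)
  then obtain b where b: "t < std_normal_cdf b"
    by (auto simp: eventually_at_top_linorder)
  have "a \<le> b"
    using a b std_normal_cdf_le_iff[of a b] by linarith
  then have "\<exists>x. a \<le> x \<and> x \<le> b \<and> std_normal_cdf x = t"
    using a b by (intro IVT) (simp_all add: isCont_std_normal_cdf)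
  with that show ?thesis
    by blast
qed

text \<open>
  Polya's argument: between neighbouring points of a grid of mesh \<open>1 / N\<close> a monotone function is
  squeezed between its values at these two points, so closeness at the finitely many grid points
  suffices.
\<close>

lemma eventually_uniformly_close_to_identity:
  fixes G :: "nat \<Rightarrow> real \<Rightarrow> real"
  assumes mono: "\<And>n. mono (G n)" and lim: "\<And>t. t \<in> {0..1} \<Longrightarrow> (\<lambda>n. G n t) \<longlonglongrightarrow> t"
    and \<epsilon>: "\<epsilon> > 0"
  shows "\<forall>\<^sub>F n in sequentially. \<forall>t\<in>{0..1}. \<bar>G n t - t\<bar> < \<epsilon>"
proof -
  obtain K where K: "inverse (real (Suc K)) < \<epsilon> / 2"
    using reals_Archimedean[of "\<epsilon> / 2"] \<epsilon> by auto
  define N where "N = Suc K"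
  have N: "N > 0" "1 / real N < \<epsilon> / 2"
    using K by (auto simp: N_def inverse_eq_divide)
  have "\<forall>\<^sub>F n in sequentially. \<forall>i\<in>{..N}. \<bar>G n (real i / real N) - real i / real N\<bar> < \<epsilon> / 2"
  proof (intro eventually_ball_finite ballI)
    fix i assume "i \<in> {..N}"
    then have "(\<lambda>n. G n (real i / real N)) \<longlonglongrightarrow> real i / real N"
      using N by (intro lim) auto
    from tendstoD[OF this, of "\<epsilon> / 2"] \<epsilon>
    show "\<forall>\<^sub>F n in sequentially. \<bar>G n (real i / real N) - real i / real N\<bar> < \<epsilon> / 2"
      by (simp add: dist_real_def)
  qed simp
  then show ?thesis
  proof (eventually_elim, intro ballI)
    fix n and t :: real
    assume grid: "\<forall>i\<in>{..N}. \<bar>G n (real i / real N) - real i / real N\<bar> < \<epsilon> / 2"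
      and t: "t \<in> {0..1}"
    show "\<bar>G n t - t\<bar> < \<epsilon>"
    proof (cases "t = 1")
      case True
      with grid[rule_format, of N] N \<epsilon> show ?thesis
        by simp
    next
      case False
      define i where "i = nat \<lfloor>t * real N\<rfloor>"
      have tN: "0 \<le> t * real N" "t * real N < real N"
        using t False N by auto
      then have i: "real i \<le> t * real N" "t * real N < real (Suc i)" "Suc i \<le> N"
        unfolding i_def by linarith+
      then have t_between: "real i / real N \<le> t" "t \<le> real (Suc i) / real N"
        using N by (auto simp: field_simps)
      have step: "real (Suc i) / real N = real i / real N + 1 / real N"
        by (simp add: add_divide_distrib)
      have "G n (real i / real N) \<le> G n t" "G n t \<le> G n (real (Suc i) / real N)"
        using mono t_between by (auto dest: monoD)
      moreover have "\<bar>G n (real i / real N) - real i / real N\<bar> < \<epsilon> / 2"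
        "\<bar>G n (real (Suc i) / real N) - real (Suc i) / real N\<bar> < \<epsilon> / 2"
        by (rule grid[rule_format], use i in simp)+
      ultimately show ?thesis
        using t_between step N by linarith
    qed
  qed
qed

text \<open>
  The transformed variables lie strictly between \<open>0\<close> and \<open>1\<close>, so outside that interval the empirical
  distribution is deterministic and equals its expectation.
\<close>

lemma empirical_distribution_outside:
  assumes "n \<ge> 1"
  shows "t \<le> 0 \<Longrightarrow> empirical_distribution X n t \<omega> = 0"
    and "1 \<le> t \<Longrightarrow> empirical_distribution X n t \<omega> = 1"
proof -
  assume "t \<le> 0"
  then have "indicat_real {..t} (std_normal_cdf (X i \<omega>)) = 0" for i
    using std_normal_cdf_bounds(1)[of "X i \<omega>"] by (simp add: indicator_def)
  then show "empirical_distribution X n t \<omega> = 0"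
    by (simp add: empirical_distribution_def)
next
  assume "1 \<le> t"
  then have "indicat_real {..t} (std_normal_cdf (X i \<omega>)) = 1" for i
    using std_normal_cdf_bounds(2)[of "X i \<omega>"] by (simp add: indicator_def)
  then show "empirical_distribution X n t \<omega> = 1"
    using assms by (simp add: empirical_distribution_def)
qed

lemma indicator_std_normal_cdf:
  "indicat_real {..std_normal_cdf x} (std_normal_cdf y) = indicat_real {..x} y"
  by (simp add: indicator_def std_normal_cdf_le_iff)

lemma mono_empirical_distribution: "mono (\<lambda>t. empirical_distribution X n t \<omega>)"
  unfolding empirical_distribution_def
  by (intro monoI mult_left_mono sum_mono) (auto simp: indicator_def)

lemma expectation_empirical_distribution:
  assumes M: "prob_space M" and X: "standardized_gaussian_process M X"
    and n: "n \<ge> 1" and t: "0 < t" "t < 1"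
  shows "(\<integral>\<omega>. empirical_distribution X n t \<omega> \<partial>M) = t"
proof -
  interpret prob_space M by fact
  obtain x where x: "std_normal_cdf x = t"
    using ex_std_normal_cdf_eq[OF t] .
  have *: "integrable M (\<lambda>\<omega>. indicat_real {..x} (X k \<omega>))"
    "(\<integral>\<omega>. indicat_real {..x} (X k \<omega>) \<partial>M) = t" if "k \<ge> 1" for k
  proof -
    note distr = distr_standardized_gaussian_process[OF X that]
    note [measurable] = distr(1)
    show "integrable M (\<lambda>\<omega>. indicat_real {..x} (X k \<omega>))"
      by (rule integrable_const_bound[where B=1]) (auto simp: indicator_def)
    have "(\<integral>\<omega>. indicat_real {..x} (X k \<omega>) \<partial>M) = (\<integral>y. indicat_real {..x} y \<partial>distr M borel (X k))"
      by (subst integral_distr) simp_all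
    also have "\<dots> = t"
      using x unfolding distr(2) by (simp add: std_normal_cdf_def cdf_def)
    finally show "(\<integral>\<omega>. indicat_real {..x} (X k \<omega>) \<partial>M) = t" .
  qed
  have "(\<integral>\<omega>. empirical_distribution X n t \<omega> \<partial>M) =
      (1 / real n) * (\<integral>\<omega>. (\<Sum>k=1..n. indicat_real {..x} (X k \<omega>)) \<partial>M)"
    unfolding empirical_distribution_def x[symmetric] indicator_std_normal_cdf
    by (rule integral_mult_right_zero)
  also have "(\<integral>\<omega>. (\<Sum>k=1..n. indicat_real {..x} (X k \<omega>)) \<partial>M) = (\<Sum>k=1..n. t)"
  proof -
    have "(\<integral>\<omega>. (\<Sum>k=1..n. indicat_real {..x} (X k \<omega>)) \<partial>M) =
        (\<Sum>k=1..n. \<integral>\<omega>. indicat_real {..x} (X k \<omega>) \<partial>M)"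
      by (intro Bochner_Integration.integral_sum *(1)) simp
    also have "\<dots> = (\<Sum>k=1..n. t)"
      by (intro sum.cong refl *(2)) simp
    finally show ?thesis .
  qed
  finally show ?thesis
    using n by simp
qed

text \<open>
  Inside the unit interval \<open>t = std_normal_cdf x\<close> for some \<open>x\<close>, and strict monotonicity turns the event
  that the transformed variable is at most \<open>t\<close> into the event that the original one is at most \<open>x\<close>.
\<close>

lemma empirical_distribution_tendsto:
  assumes conv: "\<And>x. (\<lambda>n. cdf (empirical_measure X n \<omega>) x) \<longlonglongrightarrow> std_normal_cdf x"
    and t: "t \<in> {0..1}"
  shows "(\<lambda>n. empirical_distribution X n t \<omega>) \<longlonglongrightarrow> t"
proof (cases "0 < t \<and> t < 1")
  case True
  then obtain x where x: "std_normal_cdf x = t"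
    using ex_std_normal_cdf_eq by blast
  have "\<forall>\<^sub>F n in sequentially. cdf (empirical_measure X n \<omega>) x = empirical_distribution X n t \<omega>"
    using eventually_ge_at_top[of 1]
    by eventually_elim
      (simp only: cdf_empirical_measure empirical_distribution_def x[symmetric] indicator_std_normal_cdf)
  with conv[of x] show ?thesis
    unfolding x by (rule Lim_transform_eventually)
next
  case False
  then have "t = 0 \<or> t = 1"
    using t by auto
  have "\<forall>\<^sub>F n in sequentially. t = empirical_distribution X n t \<omega>"
    using eventually_ge_at_top[of 1]
  proof eventually_elim
    case (elim n)
    then show ?case
      using \<open>t = 0 \<or> t = 1\<close> empirical_distribution_outside[of n t X \<omega>] by auto
  qed
  then show ?thesis
    by (rule Lim_transform_eventually[OF tendsto_const])
qed

theorem lemma1: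
  fixes M :: "'a measure" and X :: "nat \<Rightarrow> 'a \<Rightarrow> real"
  assumes "prob_space M"
    and "standardized_gaussian_process M X"
    and "\<And>\<gamma>::real. \<gamma> > 1 \<Longrightarrow>
      summable (\<lambda>i. root 3 (dependence_measure M X (nat \<lfloor>\<gamma> ^ Suc i\<rfloor>) / (real_of_int \<lfloor>\<gamma> ^ Suc i\<rfloor>)\<^sup>2))"
  shows "AE \<omega> in M.
      (\<lambda>n. SUP t. \<bar>empirical_distribution X n t \<omega> - (LINT \<omega>'|M. empirical_distribution X n t \<omega>')\<bar>)
        \<longlonglongrightarrow> 0"
proof -
  have "AE \<omega> in M. \<forall>x. (\<lambda>n. cdf (empirical_measure X n \<omega>) x) \<longlonglongrightarrow> std_normal_cdf x"
    using assms by (rule AE_cdf_empirical_measure_tendsto)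
  then show ?thesis
  proof eventually_elim
    case (elim \<omega>)
    define D where "D n t = \<bar>empirical_distribution X n t \<omega> - (LINT \<omega>'|M. empirical_distribution X n t \<omega>')\<bar>" for n t
    interpret prob_space M by fact
    show ?case
      unfolding D_def[symmetric]
    proof (rule LIMSEQ_I)
      fix \<epsilon> :: real assume \<epsilon>: "\<epsilon> > 0"
      have "\<forall>\<^sub>F n in sequentially. \<forall>t\<in>{0..1}. \<bar>empirical_distribution X n t \<omega> - t\<bar> < \<epsilon> / 2"
        using elim \<epsilon>
        by (intro eventually_uniformly_close_to_identity mono_empirical_distribution
            empirical_distribution_tendsto) auto
      then have "\<forall>\<^sub>F n in sequentially. \<bar>SUP t. D n t\<bar> < \<epsilon>"
        using eventually_ge_at_top[of 1]
      proof eventually_elim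
        case (elim n)
        have D_le: "D n t \<le> \<epsilon> / 2" for t
        proof (cases "0 < t \<and> t < 1")
          case True
          then show ?thesis
            using elim expectation_empirical_distribution[OF assms(1,2) elim(2), of t]
            by (auto simp: D_def intro: less_imp_le)
        next
          case False
          then have "t \<le> 0 \<or> 1 \<le> t"
            by auto
          then obtain c where c: "empirical_distribution X n t \<omega>' = c" for \<omega>'
            using empirical_distribution_outside[OF elim(2), of t X] by metis
          have "D n t = 0"
            unfolding D_def c by (simp add: prob_space)
          with \<epsilon> show ?thesis
            by simp
        qed
        have "bdd_above (range (D n))"
          using D_le by (intro bdd_aboveI[of _ "\<epsilon> / 2"]) auto
        then have "D n 0 \<le> (SUP t. D n t)"
          by (intro cSUP_upper) auto
        moreover have "0 \<le> D n 0"
          by (simp add: D_def)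
        moreover have "(SUP t. D n t) \<le> \<epsilon> / 2"
          using D_le by (intro cSUP_least) auto
        ultimately show ?case
          using \<epsilon> by linarith
      qed
      then show "\<exists>n0. \<forall>n\<ge>n0. norm ((SUP t. D n t) - 0) < \<epsilon>"
        by (simp add: eventually_sequentially)
    qed
  qed
qed

end
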